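(* Let $f_1$ be a bent function on $\mathbb{F}_2^{2m}$ in the class $\mathcal{GMM}_{m+1}$. Then there exist bent functions $f_2,f_3,f_4$ on $\mathbb{F}_2^{2m}$ such that the concatenation $f=f_1||f_2||f_3||f_4$ on $\mathbb{F}_2^{2m+2}$ is a bent function in the class $\mathcal{M}^{\#}$. Consequently, every bent function in $\mathcal{GMM}_{m+1}$ (even those outside $\mathcal{M}^{\#}$) is the restriction to $\mathbb{F}_2^{2m}\times\{(0,0)\}$ of a bent function in $\mathcal{M}^{\#}$ in a larger number of variables.
   Context: $m$ is a positive integer and "$\cdot$" is the standard dot product over $\mathbb{F}_2$. For $f\colon\mathbb{F}_2^n\to\mathbb{F}_2$, $W_f(\omega)=\sum_{x\in\mathbb{F}_2^n}(-1)^{f(x)+\omega\cdot x}$. For $n$ even, $f$ is bent if $W_f(\omega)=\pm2^{n/2}$ for all $\omega\in\mathbb{F}_2^n$. The class $\mathcal{GMM}_{m+1}$ (in $2m$ variables) consists of all functions $f\colon\mathbb{F}_2^{m-1}\times\mathbb{F}_2^{m+1}\to\mathbb{F}_2$ of the form $f(x,y)=x\cdot\phi(y)+h(y)$ with $\phi\colon\mathbb{F}_2^{m+1}\to\mathbb{F}_2^{m-1}$ and $h\colon\mathbb{F}_2^{m+1}\to\mathbb{F}_2$ ($\mathbb{F}_2^{m-1}\times\mathbb{F}_2^{m+1}$ is identified with $\mathbb{F}_2^{2m}$). The Maiorana-McFarland class $\mathcal{M}$ in $n=2r$ variables is the set of functions $f(x,y)=x\cdot\pi(y)+h(y)$, $x,y\in\mathbb{F}_2^{r}$,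 with $\pi$ a permutation of $\mathbb{F}_2^{r}$ and $h$ an arbitrary Boolean function on $\mathbb{F}_2^r$. The completed class $\mathcal{M}^{\#}$ is the set of all functions $z\mapsto f(zA+b)+c\cdot z+d$ with $f\in\mathcal{M}$, $A\in GL(n,\mathbb{F}_2)$, $b,c\in\mathbb{F}_2^n$, $d\in\mathbb{F}_2$. The concatenation $f=f_1||f_2||f_3||f_4$ of Boolean functions $f_i$ on $\mathbb{F}_2^n$ is the function on $\mathbb{F}_2^{n+2}$ with $f(z,0,0)=f_1(z)$, $f(z,0,1)=f_2(z)$, $f(z,1,0)=f_3(z)$, $f(z,1,1)=f_4(z)$ for $z\in\mathbb{F}_2^n$. *)

theory Defs
  imports "HOL-Library.Z2" "HOL-Library.FuncSet" "Jordan_Normal_Form.Matrix"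
begin

text \<open>
  The space \<open>\<bbbF>\<^sub>2\<^sup>n\<close> is \<^term>\<open>carrier_vec n :: bit vec set\<close>; a product of two such spaces is identified
  with the space of the summed dimension through \<^const>\<open>append_vec\<close>. A Boolean function in \<open>n\<close>
  variables is a function on \<^typ>\<open>bit vec\<close> of which only the values on \<^term>\<open>carrier_vec n\<close>
  matter, so every notion below depends on these values only.
\<close>

type_synonym boolfun = "bit vec \<Rightarrow> bit"

definition walsh :: "nat \<Rightarrow> boolfun \<Rightarrow> bit vec \<Rightarrow> int" where
  "walsh n f w = (\<Sum>x\<in>carrier_vec n. (- 1) ^ of_bit (f x + w \<bullet> x))"

definition bent :: "nat \<Rightarrow> boolfun \<Rightarrow> bool" where
  "bent n f \<longleftrightarrow> even n \<and>
     (\<forall>w\<in>carrier_vec n. walsh n f w = 2 ^ (n div 2) \<or> walsh n f w = - (2 ^ (n div 2)))"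

text \<open>\<open>GMM m\<close> is the class with subscript \<open>m + 1\<close>, in \<open>2m\<close> variables (for \<open>m \<ge> 1\<close>).\<close>

definition GMM :: "nat \<Rightarrow> boolfun set" where
  "GMM m = {f. \<exists>\<phi> h. \<phi> \<in> carrier_vec (m + 1) \<rightarrow> carrier_vec (m - 1) \<and>
     (\<forall>x\<in>carrier_vec (m - 1). \<forall>y\<in>carrier_vec (m + 1). f (x @\<^sub>v y) = x \<bullet> \<phi> y + h y)}"

text \<open>\<open>MM r\<close> and \<open>MM_completed r\<close> are the classes in \<open>n = 2r\<close> variables.\<close>

definition MM :: "nat \<Rightarrow> boolfun set" where
  "MM r = {f. \<exists>\<pi> h. bij_betw \<pi> (carrier_vec r) (carrier_vec r) \<and>
     (\<forall>x\<in>carrier_vec r. \<forall>y\<in>carrier_vec r. f (x @\<^sub>v y) = x \<bullet> \<pi> y + h y)}"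

definition GL2 :: "nat \<Rightarrow> bit mat set" where
  "GL2 n = {A \<in> carrier_mat n n. invertible_mat A}"

text \<open>The row vector \<open>z A\<close> is \<^term>\<open>transpose_mat A *\<^sub>v z\<close>.\<close>

definition MM_completed :: "nat \<Rightarrow> boolfun set" where
  "MM_completed r = {g. \<exists>f\<in>MM r. \<exists>A\<in>GL2 (2 * r).
     \<exists>b\<in>carrier_vec (2 * r). \<exists>c\<in>carrier_vec (2 * r). \<exists>d.
       \<forall>z\<in>carrier_vec (2 * r). g z = f (transpose_mat A *\<^sub>v z + b) + c \<bullet> z + d}"

definition concat4 :: "nat \<Rightarrow> boolfun \<Rightarrow> boolfun \<Rightarrow> boolfun \<Rightarrow> boolfun \<Rightarrow> boolfun" where
  "concat4 n f1 f2 f3 f4 v =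
     (let z = vec_first v n in
      if v $ n = 0 then (if v $ (n + 1) = 0 then f1 z else f2 z)
      else (if v $ (n + 1) = 0 then f3 z else f4 z))"

end

theory Submission
  imports Defs "Jordan_Normal_Form.Determinant"
begin

text \<open>
  A function \<open>x \<bullet> \<phi>(y) + h(y)\<close> in \<open>\<G>\<M>\<M>\<^sub>m\<^sub>+\<^sub>1\<close> is bent iff every fibre of \<open>\<phi>\<close> has four
  points and \<open>h(y) + b \<bullet> y\<close> sums to 1 over it, for every \<open>b\<close>: the Walsh coefficients are
  character sums over the fibres, Parseval gives the size of a fibre, and a sum of four signs is
  \<open>\<plusminus>2\<close> iff their product is \<open>-1\<close>. Choose \<open>\<psi>\<close> mapping each fibre bijectively onto \<open>\<bbbF>\<^sub>2\<^sup>2\<close>. Then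
  \<open>(\<phi>, \<psi>)\<close> is a permutation, so \<open>f\<^sub>1(x, y) + s \<bullet> \<psi>(y)\<close>, with \<open>s \<in> \<bbbF>\<^sub>2\<^sup>2\<close>, is a
  Maiorana-McFarland function after the variables \<open>s\<close> are grouped with \<open>x\<close>. Its restriction to a fixed
  \<open>s\<close> is again bent, since \<open>s \<bullet> \<psi>\<close> sums to 0 over every fibre.
\<close>

(* They rewrite + and * on bit to XOR and AND, which hides the ring structure. *)
declare add_bit_eq_xor [simp del] mult_bit_eq_and [simp del]

section \<open>Characters and sums over binary vectors\<close>

text \<open>The nontrivial additive character of the two-element field, with integer values, so that
  \<open>walsh\<close> becomes a character sum.\<close>

definition chi :: "bit \<Rightarrow> int" where
  "chi b = (- 1) ^ of_bit b"

lemma chi_simps [simp]: "chi 0 = 1" "chi 1 = - 1"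
  by (simp_all add: chi_def)

lemma bit_add_self [simp]: "(b :: bit) + b = 0"
  by (cases b) simp_all

lemma chi_add: "chi (a + b) = chi a * chi b"
  by (cases a; cases b) simp_all

lemma chi_mult_self [simp]: "chi a * chi a = 1"
  by (cases a) simp_all

text \<open>Basis of the inductions on the dimension; unfolded twice it enumerates
  \<open>carrier_vec 2\<close>.\<close>

lemma carrier_vec_Suc_bit:
  "(carrier_vec (Suc n) :: bit vec set) = vCons 0 ` carrier_vec n \<union> vCons 1 ` carrier_vec n"
proof (intro equalityI subsetI)
  fix v :: "bit vec" assume v: "v \<in> carrier_vec (Suc n)"
  show "v \<in> vCons 0 ` carrier_vec n \<union> vCons 1 ` carrier_vec n"
  proof (cases v)
    case vNil with v show ?thesis by auto
  next
    case (vCons a w) with v show ?thesis by (cases a) auto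
  qed
qed auto

lemma carrier_vec_0: "carrier_vec 0 = {vNil}"
  by (auto intro!: eq_vecI)

lemma finite_carrier_bit_vec [simp]: "finite (carrier_vec n :: bit vec set)"
  by (induction n) (auto simp: carrier_vec_0 carrier_vec_Suc_bit)

lemma sum_carrier_vec_Suc:
  fixes F :: "bit vec \<Rightarrow> 'a :: comm_monoid_add"
  shows "(\<Sum>v\<in>carrier_vec (Suc n). F v) = (\<Sum>v\<in>carrier_vec n. F (vCons 0 v) + F (vCons 1 v))"
proof -
  have "(\<Sum>v\<in>carrier_vec (Suc n). F v)
      = sum F (vCons 0 ` carrier_vec n) + sum F (vCons 1 ` carrier_vec n)"
    unfolding carrier_vec_Suc_bit by (rule sum.union_disjoint) auto
  also have "\<dots> = (\<Sum>v\<in>carrier_vec n. F (vCons 0 v)) + (\<Sum>v\<in>carrier_vec n. F (vCons 1 v))"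
    by (simp add: sum.reindex inj_on_def)
  finally show ?thesis by (simp add: sum.distrib)
qed

lemma card_carrier_bit_vec: "card (carrier_vec n :: bit vec set) = 2 ^ n"
proof (induction n)
  case (Suc n)
  have "card (carrier_vec (Suc n) :: bit vec set) = (\<Sum>v\<in>(carrier_vec (Suc n) :: bit vec set). 1)"
    by simp
  also have "\<dots> = 2 ^ Suc n"
    unfolding sum_carrier_vec_Suc using Suc by simp
  finally show ?case .
qed (simp add: carrier_vec_0)

lemma vec_first_append [simp]: "x \<in> carrier_vec a \<Longrightarrow> vec_first (x @\<^sub>v y) a = x"
  by (auto simp: vec_first_def)

lemma vec_last_append [simp]: "y \<in> carrier_vec b \<Longrightarrow> vec_last (x @\<^sub>v y) b = y"
  by (auto simp: vec_last_def)

lemma sum_carrier_vec_append: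
  fixes F :: "'b vec \<Rightarrow> 'a :: comm_monoid_add"
  shows "(\<Sum>v\<in>carrier_vec (a + b). F v) = (\<Sum>x\<in>carrier_vec a. \<Sum>y\<in>carrier_vec b. F (x @\<^sub>v y))"
proof -
  have "(\<Sum>v\<in>carrier_vec (a + b). F v)
      = (\<Sum>(x, y)\<in>carrier_vec a \<times> carrier_vec b. F (x @\<^sub>v y))"
    by (rule sum.reindex_bij_witness[where i = "\<lambda>(x, y). x @\<^sub>v y"
          and j = "\<lambda>v. (vec_first v a, vec_last v b)"]) auto
  then show ?thesis by (simp add: sum.cartesian_product)
qed

text \<open>Orthogonality of characters. Splitting off the first coordinate \<open>a\<close> of
  \<open>u\<close> contributes a factor \<open>1 + chi a\<close>, which is 2 for
  \<open>a = 0\<close> and 0 for \<open>a = 1\<close>.\<close>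

lemma sum_chi_scalar_prod:
  "u \<in> carrier_vec n \<Longrightarrow>
    (\<Sum>x\<in>carrier_vec n. chi (u \<bullet> x)) = (if u = 0\<^sub>v n then 2 ^ n else 0)"
proof (induction n arbitrary: u)
  case (Suc n)
  then obtain a w where u: "u = vCons a w" and w: "w \<in> carrier_vec n"
    unfolding carrier_vec_Suc_bit by auto
  show ?case using Suc.IH[OF w]
    by (cases a) (simp_all add: sum_carrier_vec_Suc u zero_vec_Suc chi_add flip: sum_distrib_left)
qed (simp add: carrier_vec_0)

lemma bit_vec_add_eq_0_iff:
  fixes u v :: "bit vec"
  assumes "u \<in> carrier_vec n" "v \<in> carrier_vec n"
  shows "u + v = 0\<^sub>v n \<longleftrightarrow> u = v"
proof
  have *: "a + b = 0 \<Longrightarrow> a = b" for a b :: bit by (cases a; cases b) simp_all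
  assume eq: "u + v = 0\<^sub>v n"
  show "u = v"
  proof (rule eq_vecI)
    fix i assume i: "i < dim_vec v"
    have "(u + v) $ i = 0" using eq i assms by simp
    then show "u $ i = v $ i" using i * by simp
  qed (use assms in simp)
qed (use assms in auto)

text \<open>A linear form on a plane takes the value 1 either never or at exactly two of the four
  points. This is what keeps the added term balanced on the fibres.\<close>

lemma sum_scalar_prod_carrier_vec_2:
  "c \<in> carrier_vec 2 \<Longrightarrow> (\<Sum>s\<in>carrier_vec 2. c \<bullet> s) = (0 :: bit)"
  by (auto simp: numeral_2_eq_2 carrier_vec_0 carrier_vec_Suc_bit sum_carrier_vec_Suc)

section \<open>Bent functions that are affine in a block of variables\<close>

lemma walsh_chi: "walsh n f w = (\<Sum>x\<in>carrier_vec n. chi (f x + w \<bullet> x))"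
  by (simp add: walsh_def chi_def)

text \<open>For fixed \<open>y\<close> the exponent is affine in \<open>x\<close> with linear part
  \<open>\<phi> y + a\<close>. Summing over \<open>x\<close> first, orthogonality leaves only the
  fibre over \<open>a\<close>, each point with weight \<open>2 ^ k\<close>.\<close>

lemma walsh_block_linear:
  fixes \<phi> :: "bit vec \<Rightarrow> bit vec"
  assumes \<phi>: "\<phi> \<in> carrier_vec l \<rightarrow> carrier_vec k"
    and f: "\<And>x y. x \<in> carrier_vec k \<Longrightarrow> y \<in> carrier_vec l \<Longrightarrow> f (x @\<^sub>v y) = x \<bullet> \<phi> y + h y"
    and a: "a \<in> carrier_vec k" and b: "b \<in> carrier_vec l"
  shows "walsh (k + l) f (a @\<^sub>v b) = 2 ^ k * (\<Sum>y | y \<in> carrier_vec l \<and> \<phi> y = a. chi (h y + b \<bullet> y))"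
proof -
  have pt: "f (x @\<^sub>v y) + (a @\<^sub>v b) \<bullet> (x @\<^sub>v y) = (h y + b \<bullet> y) + (\<phi> y + a) \<bullet> x"
    if x: "x \<in> carrier_vec k" and y: "y \<in> carrier_vec l" for x y
  proof -
    have p: "\<phi> y \<in> carrier_vec k" using \<phi> y by auto
    have "(a @\<^sub>v b) \<bullet> (x @\<^sub>v y) = a \<bullet> x + b \<bullet> y"
      by (rule scalar_prod_append[OF a b x y])
    moreover have "(\<phi> y + a) \<bullet> x = x \<bullet> \<phi> y + a \<bullet> x"
      using add_scalar_prod_distrib[OF p a x] comm_scalar_prod[OF p x] by simp
    ultimately show ?thesis using f[OF x y] by (simp add: ac_simps)
  qed
  have "walsh (k + l) f (a @\<^sub>v b)
      = (\<Sum>x\<in>carrier_vec k. \<Sum>y\<in>carrier_vec l. chi (h y + b \<bullet> y) * chi ((\<phi> y + a) \<bullet> x))"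
    unfolding walsh_chi sum_carrier_vec_append
    by (intro sum.cong refl) (simp add: pt flip: chi_add)
  also have "\<dots> = (\<Sum>y\<in>carrier_vec l. chi (h y + b \<bullet> y) * (\<Sum>x\<in>carrier_vec k. chi ((\<phi> y + a) \<bullet> x)))"
    by (subst sum.swap) (simp add: sum_distrib_left)
  also have "\<dots> = (\<Sum>y\<in>carrier_vec l. if \<phi> y = a then 2 ^ k * chi (h y + b \<bullet> y) else 0)"
  proof (intro sum.cong refl)
    fix y :: "bit vec" assume y: "y \<in> carrier_vec l"
    then have p: "\<phi> y \<in> carrier_vec k" using \<phi> by auto
    show "chi (h y + b \<bullet> y) * (\<Sum>x\<in>carrier_vec k. chi ((\<phi> y + a) \<bullet> x))
        = (if \<phi> y = a then 2 ^ k * chi (h y + b \<bullet> y) else 0)"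
      using sum_chi_scalar_prod[of "\<phi> y + a" k] bit_vec_add_eq_0_iff[OF p a] p a by simp
  qed
  also have "\<dots> = (\<Sum>y | y \<in> carrier_vec l \<and> \<phi> y = a. 2 ^ k * chi (h y + b \<bullet> y))"
    by (simp add: sum.If_cases Int_def)
  finally show ?thesis by (simp add: sum_distrib_left)
qed

text \<open>Parseval for the sign function of \<open>h\<close> cut off outside \<open>S\<close>:
  when the square is expanded, the sum over \<open>b\<close> kills every pair with
  \<open>y \<noteq> z\<close>.\<close>

lemma sum_chi_parseval:
  fixes S :: "bit vec set"
  assumes S: "S \<subseteq> carrier_vec l"
  shows "(\<Sum>b\<in>carrier_vec l. (\<Sum>y\<in>S. chi (h y + b \<bullet> y)) ^ 2) = 2 ^ l * int (card S)"
proof -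
  have fin: "finite S" using S by (rule finite_subset) simp
  have prod: "chi (h y + b \<bullet> y) * chi (h z + b \<bullet> z) = chi (h y) * chi (h z) * chi ((y + z) \<bullet> b)"
    if "y \<in> S" "z \<in> S" "b \<in> carrier_vec l" for y z b
  proof -
    have c: "y \<in> carrier_vec l" "z \<in> carrier_vec l" using that S by auto
    have "(y + z) \<bullet> b = b \<bullet> y + b \<bullet> z"
      using add_scalar_prod_distrib[OF c that(3)] comm_scalar_prod[OF c(1) that(3)]
        comm_scalar_prod[OF c(2) that(3)] by simp
    then show ?thesis by (simp add: chi_add)
  qed
  have "(\<Sum>b\<in>carrier_vec l. (\<Sum>y\<in>S. chi (h y + b \<bullet> y)) ^ 2)
      = (\<Sum>b\<in>carrier_vec l. \<Sum>y\<in>S. \<Sum>z\<in>S. chi (h y) * chi (h z) * chi ((y + z) \<bullet> b))"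
    by (intro sum.cong refl) (simp add: power2_eq_square sum_product prod)
  also have "\<dots> = (\<Sum>y\<in>S. \<Sum>z\<in>S. \<Sum>b\<in>carrier_vec l. chi (h y) * chi (h z) * chi ((y + z) \<bullet> b))"
    by (subst sum.swap[of _ S "carrier_vec l"], rule sum.cong[OF refl], rule sum.swap)
  also have "\<dots> = (\<Sum>y\<in>S. \<Sum>z\<in>S. if y = z then 2 ^ l else 0)"
  proof (intro sum.cong refl)
    fix y z assume "y \<in> S" "z \<in> S"
    then have c: "y \<in> carrier_vec l" "z \<in> carrier_vec l" using S by auto
    show "(\<Sum>b\<in>carrier_vec l. chi (h y) * chi (h z) * chi ((y + z) \<bullet> b))
        = (if y = z then 2 ^ l else 0)"
      using sum_chi_scalar_prod[of "y + z" l] bit_vec_add_eq_0_iff[OF c] c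
      by (simp flip: sum_distrib_left)
  qed
  also have "\<dots> = 2 ^ l * int (card S)"
    using fin by simp
  finally show ?thesis .
qed

text \<open>Four signs add up to 2 or -2 exactly when one or three of them are negative, that is,
  when the number of ones among the \<open>g y\<close> is odd.\<close>

lemma sum_chi_card_4:
  assumes "card S = 4"
  shows "(\<Sum>y\<in>S. chi (g y)) = 2 \<or> (\<Sum>y\<in>S. chi (g y)) = - 2 \<longleftrightarrow> (\<Sum>y\<in>S. g y) = 1"
proof -
  obtain a b c d where "S = {a, b, c, d}" and "distinct [a, b, c, d]"
    using assms by (auto simp: numeral_eq_Suc card_Suc_eq)
  then have "(\<Sum>y\<in>S. chi (g y)) = chi (g a) + chi (g b) + chi (g c) + chi (g d)"
    and "(\<Sum>y\<in>S. g y) = g a + g b + g c + g d"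
    by (auto simp: ac_simps)
  then show ?thesis
    by (cases "g a"; cases "g b"; cases "g c"; cases "g d") simp_all
qed

section \<open>Bentness read off from the fibres\<close>

lemma ball_carrier_vec_append:
  "(\<forall>w\<in>carrier_vec (a + b). P w) \<longleftrightarrow> (\<forall>x\<in>carrier_vec a. \<forall>y\<in>carrier_vec b. P (x @\<^sub>v y))"
proof
  assume r: "\<forall>x\<in>carrier_vec a. \<forall>y\<in>carrier_vec b. P (x @\<^sub>v y)"
  show "\<forall>w\<in>carrier_vec (a + b). P w"
  proof
    fix w :: "'a vec" assume "w \<in> carrier_vec (a + b)"
    then show "P w"
      using r[rule_format, of "vec_first w a" "vec_last w b"] by simp
  qed
qed auto

text \<open>Here \<open>k\<close> plays the role of \<open>m - 1\<close>. Walsh coefficients are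
  \<open>2 ^ k\<close> times fibre sums, and bentness asks for absolute value
  \<open>2 ^ (k + 1)\<close>, so every fibre sum must be 2 or -2.\<close>

lemma bent_gmm_iff:
  fixes \<phi> :: "bit vec \<Rightarrow> bit vec"
  assumes \<phi>: "\<phi> \<in> carrier_vec (k + 2) \<rightarrow> carrier_vec k"
    and f: "\<forall>x\<in>carrier_vec k. \<forall>y\<in>carrier_vec (k + 2). f (x @\<^sub>v y) = x \<bullet> \<phi> y + h y"
  shows "bent (2 * k + 2) f \<longleftrightarrow>
    (\<forall>a\<in>carrier_vec k. card {y \<in> carrier_vec (k + 2). \<phi> y = a} = 4 \<and>
      (\<forall>b\<in>carrier_vec (k + 2). (\<Sum>y | y \<in> carrier_vec (k + 2) \<and> \<phi> y = a. h y + b \<bullet> y) = 1))"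
    (is "_ \<longleftrightarrow> (\<forall>a\<in>_. card (?S a) = 4 \<and> _ a)")
proof -
  have dim: "2 * k + 2 = k + (k + 2)" by simp
  have sum_iff: "walsh (2 * k + 2) f (a @\<^sub>v b) = 2 ^ ((2 * k + 2) div 2) \<or>
      walsh (2 * k + 2) f (a @\<^sub>v b) = - (2 ^ ((2 * k + 2) div 2)) \<longleftrightarrow>
      (\<Sum>y\<in>?S a. chi (h y + b \<bullet> y)) = 2 \<or> (\<Sum>y\<in>?S a. chi (h y + b \<bullet> y)) = - 2"
    if "a \<in> carrier_vec k" "b \<in> carrier_vec (k + 2)" for a b
  proof -
    have pow: "(2 :: int) ^ ((2 * k + 2) div 2) = 2 ^ k * 2" "- (2 ^ k * 2) = 2 ^ k * (- 2 :: int)"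
      by simp_all
    have walsh: "walsh (2 * k + 2) f (a @\<^sub>v b) = 2 ^ k * (\<Sum>y\<in>?S a. chi (h y + b \<bullet> y))"
      unfolding dim by (rule walsh_block_linear[OF \<phi> f[rule_format] that])
    show ?thesis
      unfolding walsh pow mult_cancel_left by simp
  qed
  have "bent (2 * k + 2) f \<longleftrightarrow> (\<forall>a\<in>carrier_vec k. \<forall>b\<in>carrier_vec (k + 2).
      (\<Sum>y\<in>?S a. chi (h y + b \<bullet> y)) = 2 \<or> (\<Sum>y\<in>?S a. chi (h y + b \<bullet> y)) = - 2)"
  proof -
    have "bent (2 * k + 2) f \<longleftrightarrow> (\<forall>w\<in>carrier_vec (k + (k + 2)).
        walsh (2 * k + 2) f w = 2 ^ ((2 * k + 2) div 2) \<or>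
        walsh (2 * k + 2) f w = - (2 ^ ((2 * k + 2) div 2)))"
      unfolding bent_def dim[symmetric] by simp
    then show ?thesis
      unfolding ball_carrier_vec_append[of k "k + 2"] by (simp only: sum_iff cong: ball_cong)
  qed
  also have "\<dots> \<longleftrightarrow> (\<forall>a\<in>carrier_vec k. card (?S a) = 4 \<and>
      (\<forall>b\<in>carrier_vec (k + 2). (\<Sum>y\<in>?S a. h y + b \<bullet> y) = 1))"
  proof (intro ball_cong refl)
    fix a :: "bit vec" assume "a \<in> carrier_vec k"
    \<comment> \<open>If all \<open>2 ^ (k + 2)\<close> squared fibre sums equal 4, Parseval forces
      the fibre to have 4 points.\<close>
    have "card (?S a) = 4" if *: "\<forall>b\<in>carrier_vec (k + 2).
        (\<Sum>y\<in>?S a. chi (h y + b \<bullet> y)) = 2 \<or> (\<Sum>y\<in>?S a. chi (h y + b \<bullet> y)) = - 2"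
    proof -
      have "2 ^ (k + 2) * int (card (?S a))
          = (\<Sum>b\<in>carrier_vec (k + 2). (\<Sum>y\<in>?S a. chi (h y + b \<bullet> y)) ^ 2)"
        by (rule sum_chi_parseval[symmetric]) auto
      also have "\<dots> = (\<Sum>b\<in>(carrier_vec (k + 2) :: bit vec set). 4)"
      proof (intro sum.cong refl)
        fix b :: "bit vec" assume "b \<in> carrier_vec (k + 2)"
        with * have "(\<Sum>y\<in>?S a. chi (h y + b \<bullet> y)) = 2 \<or> (\<Sum>y\<in>?S a. chi (h y + b \<bullet> y)) = - 2"
          by blast
        then show "(\<Sum>y\<in>?S a. chi (h y + b \<bullet> y)) ^ 2 = 4"
          by (elim disjE) simp_all
      qed
      also have "\<dots> = 2 ^ (k + 2) * 4" by (simp add: card_carrier_bit_vec)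
      finally have "int (card (?S a)) = 4" by simp
      then show ?thesis by simp
    qed
    \<comment> \<open>For a fibre of four points the sign condition is the parity condition; for any
      other size both sides fail.\<close>
    then show "(\<forall>b\<in>carrier_vec (k + 2).
        (\<Sum>y\<in>?S a. chi (h y + b \<bullet> y)) = 2 \<or> (\<Sum>y\<in>?S a. chi (h y + b \<bullet> y)) = - 2) \<longleftrightarrow>
      card (?S a) = 4 \<and> (\<forall>b\<in>carrier_vec (k + 2). (\<Sum>y\<in>?S a. h y + b \<bullet> y) = 1)"
      by (cases "card (?S a) = 4") (simp_all only: sum_chi_card_4, blast+)
  qed
  finally show ?thesis .
qed

text \<open>The fibres of a permutation are single points, so each fibre sum is one sign and each
  Walsh coefficient is that sign times \<open>2 ^ r\<close>.\<close>

lemma bent_MM: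
  assumes "f \<in> MM r"
  shows "bent (2 * r) f"
proof -
  obtain \<pi> h where \<pi>: "bij_betw \<pi> (carrier_vec r) (carrier_vec r :: bit vec set)"
    and f: "\<And>x y. x \<in> carrier_vec r \<Longrightarrow> y \<in> carrier_vec r \<Longrightarrow> f (x @\<^sub>v y) = x \<bullet> \<pi> y + h y"
    using assms unfolding MM_def by auto
  have *: "walsh (r + r) f (a @\<^sub>v b) = 2 ^ r \<or> walsh (r + r) f (a @\<^sub>v b) = - (2 ^ r)"
    if a: "a \<in> carrier_vec r" and b: "b \<in> carrier_vec r" for a b
  proof -
    obtain y where y: "y \<in> carrier_vec r" "\<pi> y = a"
      using \<pi> a by (metis bij_betw_iff_bijections)
    then have "{y \<in> carrier_vec r. \<pi> y = a} = {y}"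
      using \<pi> by (auto simp: bij_betw_def inj_on_def)
    moreover have "\<pi> \<in> carrier_vec r \<rightarrow> carrier_vec r"
      using \<pi> by (auto simp: bij_betw_def)
    ultimately have "walsh (r + r) f (a @\<^sub>v b) = 2 ^ r * chi (h y + b \<bullet> y)"
      using walsh_block_linear[of \<pi> r r f h, OF _ f a b] by simp
    then show ?thesis by (cases "h y + b \<bullet> y") simp_all
  qed
  then have "\<forall>w\<in>carrier_vec (r + r). walsh (r + r) f w = 2 ^ r \<or> walsh (r + r) f w = - (2 ^ r)"
    unfolding ball_carrier_vec_append by blast
  then show ?thesis
    by (simp add: bent_def mult_2)
qed

section \<open>Permutations of the variables\<close>

lemma permutation_matrix_exists:
  assumes \<sigma>: "bij_betw \<sigma> {..<n} {..<n}"
  shows "\<exists>A\<in>GL2 n. \<forall>z\<in>carrier_vec n. transpose_mat A *\<^sub>v z = vec n (\<lambda>i. z $ \<sigma> i)"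
proof
  \<comment> \<open>Column \<open>j\<close> is the unit vector at \<open>\<sigma> j\<close>, so row
    \<open>i\<close> of the transpose reads off coordinate \<open>\<sigma> i\<close>.\<close>
  define A :: "bit mat" where "A = mat n n (\<lambda>(i, j). of_bool (i = \<sigma> j))"
  have A: "A \<in> carrier_mat n n" by (simp add: A_def)
  have lt: "\<sigma> i < n" if "i < n" for i using \<sigma> that by (auto simp: bij_betw_def)
  have inj: "\<sigma> i = \<sigma> j \<longleftrightarrow> i = j" if "i < n" "j < n" for i j
    using \<sigma> that by (auto simp: bij_betw_def inj_on_def)
  have of_bool_sum: "(\<Sum>k = 0..<n. of_bool (k = a) * g k) = g a" if "a < n"
    for a and g :: "nat \<Rightarrow> bit"
  proof -
    have "(\<Sum>k = 0..<n. of_bool (k = a) * g k) = (\<Sum>k = 0..<n. if k = a then g k else 0)"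
      by (rule sum.cong) auto
    also have "\<dots> = g a" using that by simp
    finally show ?thesis .
  qed
  have tA: "transpose_mat A * A = 1\<^sub>m n"
    by (rule eq_matI) (auto simp: A_def scalar_prod_def of_bool_sum lt inj)
  \<comment> \<open>Over a field, a one-sided inverse of a square matrix is two-sided.\<close>
  then have "A * transpose_mat A = 1\<^sub>m n"
    using mat_mult_left_right_inverse[of "transpose_mat A" n A] A by simp
  with tA A have "invertible_mat A"
    unfolding invertible_mat_def inverts_mat_def by (intro conjI exI[of _ "transpose_mat A"]) auto
  with A show "A \<in> GL2 n" by (simp add: GL2_def)
  show "\<forall>z\<in>carrier_vec n. transpose_mat A *\<^sub>v z = vec n (\<lambda>i. z $ \<sigma> i)"
    by (intro ballI eq_vecI) (auto simp: A_def scalar_prod_def of_bool_sum lt)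
qed

lemma block_swap_matrix_exists:
  "\<exists>A\<in>GL2 (a + b + c). \<forall>x\<in>carrier_vec a. \<forall>y\<in>carrier_vec b. \<forall>s\<in>carrier_vec c.
     transpose_mat A *\<^sub>v ((x @\<^sub>v y) @\<^sub>v s) = (x @\<^sub>v s) @\<^sub>v y"
proof -
  let ?n = "a + b + c"
  \<comment> \<open>Position \<open>i\<close> of the result is read from position
    \<open>\<sigma> i\<close> of the source: the block \<open>s\<close> now starts at
    \<open>a\<close> instead of \<open>a + b\<close>, and the block \<open>y\<close> at
    \<open>a + c\<close> instead of \<open>a\<close>.\<close>
  define \<sigma> where "\<sigma> i = (if i < a then i else if i < a + c then i + b else i - c)" for i
  have "bij_betw \<sigma> {..<?n} {..<?n}"
    by (rule bij_betw_byWitness[where f' = "\<lambda>i. if i < a then i else if i < a + b then i + c else i - b"])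
      (auto simp: \<sigma>_def split: if_splits)
  then obtain A where A: "A \<in> GL2 ?n"
    and *: "\<And>z. z \<in> carrier_vec ?n \<Longrightarrow> transpose_mat A *\<^sub>v z = vec ?n (\<lambda>i. z $ \<sigma> i)"
    using permutation_matrix_exists by blast
  have "transpose_mat A *\<^sub>v ((x @\<^sub>v y) @\<^sub>v s) = (x @\<^sub>v s) @\<^sub>v y"
    if "x \<in> carrier_vec a" "y \<in> carrier_vec b" "s \<in> carrier_vec c" for x y s
  proof -
    have "(x @\<^sub>v y) @\<^sub>v s \<in> carrier_vec ?n" using that by simp
    then show ?thesis
      using that by (subst *) (auto intro!: eq_vecI simp: \<sigma>_def, arith, simp add: add.commute)
  qed
  with A show ?thesis by blast
qed

section \<open>Extension by bijections on the fibres\<close>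

text \<open>Treats the four constituents as one family indexed by the two new variables
  \<open>s\<close>.\<close>

lemma concat4_append:
  fixes z :: "bit vec"
  assumes "z \<in> carrier_vec n"
    and s: "s \<in> carrier_vec 2"
  shows "concat4 n (F (vec_of_list [0, 0])) (F (vec_of_list [0, 1])) (F (vec_of_list [1, 0]))
    (F (vec_of_list [1, 1])) (z @\<^sub>v s) = F s z"
proof -
  obtain p q where "s = vec_of_list [p, q]"
    using s by (auto simp: numeral_2_eq_2 carrier_vec_0 carrier_vec_Suc_bit)
  then show ?thesis
    using assms by (cases p; cases q) (simp_all add: concat4_def Let_def)
qed

text \<open>Adding \<open>e y\<close> keeps \<open>\<phi>\<close>, hence the fibres, and shifts each
  fibre parity by the sum of \<open>e\<close> over the fibre, which is 0. The criterion
  \<open>bent_gmm_iff\<close> is therefore preserved.\<close>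

lemma bent_add_balanced_on_fibres:
  fixes \<phi> :: "bit vec \<Rightarrow> bit vec"
  assumes bent: "bent (2 * k + 2) f"
    and \<phi>: "\<phi> \<in> carrier_vec (k + 2) \<rightarrow> carrier_vec k"
    and f: "\<forall>x\<in>carrier_vec k. \<forall>y\<in>carrier_vec (k + 2). f (x @\<^sub>v y) = x \<bullet> \<phi> y + h y"
    and g: "\<forall>x\<in>carrier_vec k. \<forall>y\<in>carrier_vec (k + 2). g (x @\<^sub>v y) = f (x @\<^sub>v y) + e y"
    and e: "\<forall>a\<in>carrier_vec k. (\<Sum>y | y \<in> carrier_vec (k + 2) \<and> \<phi> y = a. e y) = 0"
  shows "bent (2 * k + 2) g"
proof -
  have "g (x @\<^sub>v y) = x \<bullet> \<phi> y + (h y + e y)" if "x \<in> carrier_vec k" "y \<in> carrier_vec (k + 2)" for x y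
    using f g that by (simp add: add.assoc)
  moreover have "(\<Sum>y\<in>S. (h y + e y) + b \<bullet> y) = (\<Sum>y\<in>S. h y + b \<bullet> y) + (\<Sum>y\<in>S. e y)" for S b
    by (simp add: sum.distrib ac_simps)
  ultimately show ?thesis
    using bent e unfolding bent_gmm_iff[OF \<phi> f]
    by (subst bent_gmm_iff[OF \<phi>, where h = "\<lambda>y. h y + e y"]) (simp_all del: add_2_eq_Suc')
qed

text \<open>The first block of the image determines the fibre and the second the point inside
  it.\<close>

lemma bij_betw_append_fibrewise:
  fixes \<phi> \<psi> :: "'a \<Rightarrow> 'b vec"
  assumes \<phi>: "\<phi> \<in> D \<rightarrow> carrier_vec k"
    and \<psi>: "\<And>a. a \<in> carrier_vec k \<Longrightarrow> bij_betw \<psi> {y \<in> D. \<phi> y = a} (carrier_vec n)"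
  shows "bij_betw (\<lambda>y. \<phi> y @\<^sub>v \<psi> y) D (carrier_vec (k + n))"
proof -
  have \<phi>D: "\<phi> y \<in> carrier_vec k" if "y \<in> D" for y using \<phi> that by auto
  have \<psi>D: "\<psi> y \<in> carrier_vec n" if "y \<in> D" for y
    using bij_betwE[OF \<psi>[OF \<phi>D[OF that]]] that by auto
  show ?thesis
    unfolding bij_betw_def
  proof (intro conjI inj_onI)
    fix y z assume y: "y \<in> D" and z: "z \<in> D" and eq: "\<phi> y @\<^sub>v \<psi> y = \<phi> z @\<^sub>v \<psi> z"
    have "\<phi> y = \<phi> z" "\<psi> y = \<psi> z"
      using eq append_vec_eq[OF \<phi>D[OF y] \<phi>D[OF z]] by auto
    then show "y = z"
      using y z \<psi>[OF \<phi>D[OF y]] by (auto simp: bij_betw_def inj_on_def)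
  next
    show "(\<lambda>y. \<phi> y @\<^sub>v \<psi> y) ` D = carrier_vec (k + n)"
    proof (intro equalityI subsetI)
      fix v :: "'b vec" assume v: "v \<in> carrier_vec (k + n)"
      have "vec_last v n \<in> \<psi> ` {y \<in> D. \<phi> y = vec_first v k}"
        using \<psi>[of "vec_first v k"] by (simp add: bij_betw_def)
      then obtain y where "y \<in> D" "\<phi> y = vec_first v k" "\<psi> y = vec_last v n" by force
      then show "v \<in> (\<lambda>y. \<phi> y @\<^sub>v \<psi> y) ` D"
        using v by (intro image_eqI[of _ _ y]) auto
    qed (use \<phi>D \<psi>D in auto)
  qed
qed

section \<open>Regrouping the variables into Maiorana-McFarland form\<close>

lemma scalar_prod_append3:
  assumes "u \<in> carrier_vec a" "v \<in> carrier_vec b" "w \<in> carrier_vec c"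
    and "x \<in> carrier_vec a" "y \<in> carrier_vec b" "s \<in> carrier_vec c"
  shows "((u @\<^sub>v v) @\<^sub>v w) \<bullet> ((x @\<^sub>v y) @\<^sub>v s) = u \<bullet> x + v \<bullet> y + w \<bullet> s"
  using scalar_prod_append[of "u @\<^sub>v v" "a + b" w c "x @\<^sub>v y" s]
    scalar_prod_append[of u a v b x y] assms by simp

text \<open>Grouping \<open>s\<close> with \<open>x\<close> turns the first two terms of
  \<open>g\<close> into one scalar product of \<open>x @\<^sub>v s\<close> with
  \<open>\<phi> y @\<^sub>v \<psi> y\<close>, and the latter is a permutation of
  \<open>y\<close>.\<close>

lemma bent_MM_completed_extension:
  fixes \<phi> \<psi> :: "bit vec \<Rightarrow> bit vec"
  assumes \<phi>: "\<phi> \<in> carrier_vec (k + c) \<rightarrow> carrier_vec k"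
    and \<psi>: "\<psi> \<in> carrier_vec (k + c) \<rightarrow> carrier_vec c"
    and bij: "bij_betw (\<lambda>y. \<phi> y @\<^sub>v \<psi> y) (carrier_vec (k + c)) (carrier_vec (k + c))"
    and g: "\<forall>x\<in>carrier_vec k. \<forall>y\<in>carrier_vec (k + c). \<forall>s\<in>carrier_vec c.
      g ((x @\<^sub>v y) @\<^sub>v s) = x \<bullet> \<phi> y + s \<bullet> \<psi> y + h y"
  shows "bent (2 * (k + c)) g" "g \<in> MM_completed (k + c)"
proof -
  define f where "f v = vec_first v (k + c) \<bullet> (\<phi> (vec_last v (k + c)) @\<^sub>v \<psi> (vec_last v (k + c)))
    + h (vec_last v (k + c))" for v
  have MM: "f \<in> MM (k + c)"
    unfolding MM_def using bij by (auto simp: f_def)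
  have fg: "f ((x @\<^sub>v s) @\<^sub>v y) = g ((x @\<^sub>v y) @\<^sub>v s)"
    if xys: "x \<in> carrier_vec k" "y \<in> carrier_vec (k + c)" "s \<in> carrier_vec c" for x y s
  proof -
    have \<phi>\<psi>: "\<phi> y \<in> carrier_vec k" "\<psi> y \<in> carrier_vec c" using \<phi> \<psi> xys by auto
    have xs: "x @\<^sub>v s \<in> carrier_vec (k + c)" using xys by simp
    have "f ((x @\<^sub>v s) @\<^sub>v y) = (x @\<^sub>v s) \<bullet> (\<phi> y @\<^sub>v \<psi> y) + h y"
      unfolding f_def vec_first_append[OF xs] vec_last_append[OF xys(2)] ..
    then show ?thesis
      using g xys scalar_prod_append[OF xys(1,3) \<phi>\<psi>] by simp
  qed
  have dim: "k + (k + c) + c = 2 * (k + c)" "k + c + (k + c) = 2 * (k + c)" by simp_all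
  \<comment> \<open>Bentness passes from \<open>f\<close> to \<open>g\<close> because swapping
    blocks in both the argument and the frequency preserves the scalar product and only reorders the
    sum.\<close>
  have walsh_eq: "walsh (2 * (k + c)) g ((u @\<^sub>v v) @\<^sub>v w) = walsh (2 * (k + c)) f ((u @\<^sub>v w) @\<^sub>v v)"
    if uvw: "u \<in> carrier_vec k" "v \<in> carrier_vec (k + c)" "w \<in> carrier_vec c" for u v w
  proof -
    have "walsh (2 * (k + c)) g ((u @\<^sub>v v) @\<^sub>v w)
        = (\<Sum>x\<in>carrier_vec k. \<Sum>y\<in>carrier_vec (k + c). \<Sum>s\<in>carrier_vec c.
             chi (g ((x @\<^sub>v y) @\<^sub>v s) + ((u @\<^sub>v v) @\<^sub>v w) \<bullet> ((x @\<^sub>v y) @\<^sub>v s)))"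
      unfolding walsh_chi dim(1)[symmetric] sum_carrier_vec_append ..
    also have "\<dots> = (\<Sum>x\<in>carrier_vec k. \<Sum>y\<in>carrier_vec (k + c). \<Sum>s\<in>carrier_vec c.
             chi (f ((x @\<^sub>v s) @\<^sub>v y) + ((u @\<^sub>v w) @\<^sub>v v) \<bullet> ((x @\<^sub>v s) @\<^sub>v y)))"
    proof (intro sum.cong refl)
      fix x y s :: "bit vec"
      assume xys: "x \<in> carrier_vec k" "y \<in> carrier_vec (k + c)" "s \<in> carrier_vec c"
      have "((u @\<^sub>v v) @\<^sub>v w) \<bullet> ((x @\<^sub>v y) @\<^sub>v s) = ((u @\<^sub>v w) @\<^sub>v v) \<bullet> ((x @\<^sub>v s) @\<^sub>v y)"
        unfolding scalar_prod_append3[OF uvw xys] scalar_prod_append3[OF uvw(1,3,2) xys(1,3,2)]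
        by (simp only: ac_simps)
      then show "chi (g ((x @\<^sub>v y) @\<^sub>v s) + ((u @\<^sub>v v) @\<^sub>v w) \<bullet> ((x @\<^sub>v y) @\<^sub>v s))
          = chi (f ((x @\<^sub>v s) @\<^sub>v y) + ((u @\<^sub>v w) @\<^sub>v v) \<bullet> ((x @\<^sub>v s) @\<^sub>v y))"
        using fg[OF xys] by simp
    qed
    also have "\<dots> = (\<Sum>x\<in>carrier_vec k. \<Sum>s\<in>carrier_vec c. \<Sum>y\<in>carrier_vec (k + c).
             chi (f ((x @\<^sub>v s) @\<^sub>v y) + ((u @\<^sub>v w) @\<^sub>v v) \<bullet> ((x @\<^sub>v s) @\<^sub>v y)))"
      by (intro sum.cong refl sum.swap)
    also have "\<dots> = walsh (2 * (k + c)) f ((u @\<^sub>v w) @\<^sub>v v)"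
      unfolding walsh_chi dim(2)[symmetric]
      by (subst sum_carrier_vec_append[where a = "k + c"], subst sum_carrier_vec_append) (rule refl)
    finally show ?thesis .
  qed
  have bf: "walsh (2 * (k + c)) f w = 2 ^ (k + c) \<or> walsh (2 * (k + c)) f w = - (2 ^ (k + c))"
    if "w \<in> carrier_vec (k + c + (k + c))" for w
    using bent_MM[OF MM] that unfolding bent_def dim by auto
  have "\<forall>w\<in>carrier_vec (k + (k + c) + c).
      walsh (2 * (k + c)) g w = 2 ^ (k + c) \<or> walsh (2 * (k + c)) g w = - (2 ^ (k + c))"
    unfolding ball_carrier_vec_append[of "k + (k + c)"] ball_carrier_vec_append[of k "k + c"]
    by (intro ballI, simp only: walsh_eq, intro bf append_carrier_vec)
  then show "bent (2 * (k + c)) g"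
    unfolding bent_def dim by simp
  obtain A where A: "A \<in> GL2 (2 * (k + c))"
    and sw: "\<And>x y s. x \<in> carrier_vec k \<Longrightarrow> y \<in> carrier_vec (k + c) \<Longrightarrow> s \<in> carrier_vec c \<Longrightarrow>
      transpose_mat A *\<^sub>v ((x @\<^sub>v y) @\<^sub>v s) = (x @\<^sub>v s) @\<^sub>v y"
    using block_swap_matrix_exists[of k "k + c" c] unfolding dim by blast
  \<comment> \<open>The block swap alone witnesses membership: shift, linear term and constant are
    all zero.\<close>
  have "\<forall>z\<in>carrier_vec (k + (k + c) + c). g z = f (transpose_mat A *\<^sub>v z + 0\<^sub>v (2 * (k + c)))
      + 0\<^sub>v (2 * (k + c)) \<bullet> z + 0"
    unfolding ball_carrier_vec_append[of "k + (k + c)"] ball_carrier_vec_append[of k "k + c"]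
  proof (intro ballI)
    fix x y s :: "bit vec"
    assume xys: "x \<in> carrier_vec k" "y \<in> carrier_vec (k + c)" "s \<in> carrier_vec c"
    have "(x @\<^sub>v s) @\<^sub>v y \<in> carrier_vec (k + c + (k + c))" "(x @\<^sub>v y) @\<^sub>v s \<in> carrier_vec (k + (k + c) + c)"
      using xys by (meson append_carrier_vec)+
    then have "(x @\<^sub>v s) @\<^sub>v y \<in> carrier_vec (2 * (k + c))" "(x @\<^sub>v y) @\<^sub>v s \<in> carrier_vec (2 * (k + c))"
      unfolding dim .
    then show "g ((x @\<^sub>v y) @\<^sub>v s) = f (transpose_mat A *\<^sub>v ((x @\<^sub>v y) @\<^sub>v s) + 0\<^sub>v (2 * (k + c)))
      + 0\<^sub>v (2 * (k + c)) \<bullet> ((x @\<^sub>v y) @\<^sub>v s) + 0"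
      using fg[OF xys] by (simp add: sw[OF xys])
  qed
  then show "g \<in> MM_completed (k + c)"
    unfolding MM_completed_def dim
    by (intro CollectI bexI[OF _ MM] bexI[OF _ A] bexI[OF _ zero_carrier_vec] exI)
qed

section \<open>Construction of the constituents and their concatenation\<close>

theorem theorem3p13:
  fixes m :: nat and f1 :: "bit vec \<Rightarrow> bit"
  assumes "m \<ge> 1" and "f1 \<in> GMM m" and "bent (2 * m) f1"
  shows "(\<exists>f2 f3 f4. bent (2 * m) f2 \<and> bent (2 * m) f3 \<and> bent (2 * m) f4 \<and>
            bent (2 * m + 2) (concat4 (2 * m) f1 f2 f3 f4) \<and>
            concat4 (2 * m) f1 f2 f3 f4 \<in> MM_completed (m + 1))
       \<and> (\<exists>g. bent (2 * m + 2) g \<and> g \<in> MM_completed (m + 1) \<and>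
            (\<forall>z\<in>carrier_vec (2 * m). g (z @\<^sub>v 0\<^sub>v 2) = f1 z))"
proof -
  obtain k where m: "m = Suc k" using assms(1) by (cases m) auto
  have dim: "2 * m = 2 * k + 2" "2 * m = k + (k + 2)" "m + 1 = k + 2" "2 * m + 2 = 2 * (k + 2)"
    by (simp_all add: m)
  define D :: "bit vec set" where "D = carrier_vec (k + 2)"
  obtain \<phi> h where \<phi>: "\<phi> \<in> carrier_vec (k + 2) \<rightarrow> carrier_vec k"
    and f1: "\<forall>x\<in>carrier_vec k. \<forall>y\<in>carrier_vec (k + 2). f1 (x @\<^sub>v y) = x \<bullet> \<phi> y + h y"
    using assms(2) unfolding GMM_def by (auto simp: m)
  have bent1: "bent (2 * k + 2) f1" using assms(3) dim by simp
  \<comment> \<open>By the bentness criterion a fibre has as many points as the plane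
    \<open>carrier_vec 2\<close>.\<close>
  have "\<exists>\<beta>. bij_betw \<beta> {y \<in> D. \<phi> y = a} (carrier_vec 2 :: bit vec set)" if "a \<in> carrier_vec k" for a
  proof (rule finite_same_card_bij)
    show "card {y \<in> D. \<phi> y = a} = card (carrier_vec 2 :: bit vec set)"
      using bent1 that unfolding bent_gmm_iff[OF \<phi> f1] by (simp only: D_def card_carrier_bit_vec) simp
  qed (simp_all add: D_def)
  then obtain \<beta> where \<beta>: "\<And>a. a \<in> carrier_vec k \<Longrightarrow>
      bij_betw (\<beta> a) {y \<in> D. \<phi> y = a} (carrier_vec 2 :: bit vec set)"
    by metis
  \<comment> \<open>The bijections chosen on the separate fibres are glued into one map, since
    \<open>\<phi> y\<close> tells which fibre contains \<open>y\<close>.\<close>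
  define \<psi> where "\<psi> y = \<beta> (\<phi> y) y" for y
  have fib: "bij_betw \<psi> {y \<in> D. \<phi> y = a} (carrier_vec 2)" if "a \<in> carrier_vec k" for a
    using \<beta>[OF that] by (rule bij_betw_cong[THEN iffD1, rotated]) (simp add: \<psi>_def)
  have \<psi>: "\<psi> \<in> carrier_vec (k + 2) \<rightarrow> carrier_vec 2"
    using bij_betwE[OF fib] \<phi> unfolding D_def by blast
  define F where "F s z = f1 z + s \<bullet> \<psi> (vec_last z (k + 2))" for s z
  have bentF: "bent (2 * m) (F s)" if s: "s \<in> carrier_vec 2" for s
    unfolding dim(1)
  proof (rule bent_add_balanced_on_fibres[OF bent1 \<phi> f1])
    show "\<forall>x\<in>carrier_vec k. \<forall>y\<in>carrier_vec (k + 2). F s (x @\<^sub>v y) = f1 (x @\<^sub>v y) + s \<bullet> \<psi> y"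
      by (simp add: F_def)
    \<comment> \<open>Transported along \<open>\<psi>\<close>, the fibre sum becomes the sum of a
      linear form over the whole plane.\<close>
    have "(\<Sum>y | y \<in> carrier_vec (k + 2) \<and> \<phi> y = a. s \<bullet> \<psi> y) = 0" if "a \<in> carrier_vec k" for a
      using sum.reindex_bij_betw[OF fib[OF that], of "\<lambda>t. s \<bullet> t"]
        sum_scalar_prod_carrier_vec_2[OF s] by (simp add: D_def)
    then show "\<forall>a\<in>carrier_vec k. (\<Sum>y | y \<in> carrier_vec (k + 2) \<and> \<phi> y = a. s \<bullet> \<psi> y) = 0" by blast
  qed
  define f2 f3 f4 where "f2 = F (vec_of_list [0, 1])" and "f3 = F (vec_of_list [1, 0])"
    and "f4 = F (vec_of_list [1, 1])"
  define g where "g = concat4 (2 * m) f1 f2 f3 f4"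
  have g: "g (z @\<^sub>v s) = F s z" if z: "z \<in> carrier_vec (2 * m)" and s: "s \<in> carrier_vec 2" for z s
  proof -
    \<comment> \<open>The family at \<open>s = 0\<close> has the values of \<open>f1\<close>, since
      the added scalar product vanishes; so \<open>f1\<close> itself can serve as first
      constituent.\<close>
    have "vec_last z (k + 2) \<in> carrier_vec (k + 2)" by simp
    then have "\<psi> (vec_last z (k + 2)) \<in> carrier_vec 2" using \<psi> by blast
    then have "F (vec_of_list [0, 0]) z = f1 z"
      unfolding F_def by (auto simp: numeral_2_eq_2 carrier_vec_0 carrier_vec_Suc_bit)
    then have "concat4 (2 * m) f1 f2 f3 f4 (z @\<^sub>v s)
        = concat4 (2 * m) (F (vec_of_list [0, 0])) f2 f3 f4 (z @\<^sub>v s)"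
      using z by (simp add: concat4_def Let_def)
    then show ?thesis
      using concat4_append[OF z s, of F] by (simp add: g_def f2_def f3_def f4_def)
  qed
  have ext: "\<forall>x\<in>carrier_vec k. \<forall>y\<in>carrier_vec (k + 2). \<forall>s\<in>carrier_vec 2.
    g ((x @\<^sub>v y) @\<^sub>v s) = x \<bullet> \<phi> y + s \<bullet> \<psi> y + h y"
  proof (intro ballI)
    fix x y s :: "bit vec"
    assume xys: "x \<in> carrier_vec k" "y \<in> carrier_vec (k + 2)" "s \<in> carrier_vec 2"
    have "x @\<^sub>v y \<in> carrier_vec (2 * m)" unfolding dim(2) using xys by (intro append_carrier_vec)
    then show "g ((x @\<^sub>v y) @\<^sub>v s) = x \<bullet> \<phi> y + s \<bullet> \<psi> y + h y"
      using xys g f1 by (simp add: F_def ac_simps)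
  qed
  have "bij_betw (\<lambda>y. \<phi> y @\<^sub>v \<psi> y) (carrier_vec (k + 2)) (carrier_vec (k + 2))"
    using bij_betw_append_fibrewise[of \<phi> D k \<psi> 2] \<phi> fib unfolding D_def by blast
  note G = bent_MM_completed_extension[OF \<phi> \<psi> this ext]
  have "bent (2 * m + 2) g" "g \<in> MM_completed (m + 1)"
    unfolding dim(3,4) by (rule G)+
  moreover have "bent (2 * m) f2" "bent (2 * m) f3" "bent (2 * m) f4"
    unfolding f2_def f3_def f4_def by (intro bentF; simp add: numeral_2_eq_2)+
  moreover have "g (z @\<^sub>v 0\<^sub>v 2) = f1 z" if "z \<in> carrier_vec (2 * m)" for z
    using that by (simp add: g_def concat4_def Let_def)
  ultimately show ?thesis unfolding g_def by blast
qed

end
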